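(* Let $b\ge2$ be an integer, $c\ge2$ real, $\rho=\{\log_b c\}$ with $0<\rho<1$, $C=b^\rho$, $L=\log C$ and $B=\log b$. Let $G$ be the inverse of $u\mapsto Lu-\log u$ on $(1/L,\infty)$ (the large branch). For $J>1+\log L$, put $$R(J)=\frac1{LG(J)-1},\qquad W(J)=G(J+L)-G(J)-1.$$ Then $$W(J)=\frac1L\int_J^{J+L}R(u)\,du,\qquad R'(J)=-R(J)^2(1+R(J)).$$ In particular, $(-1)^nW^{(n)}(J)>0$ for all $n\ge0$. For every layer $j$ for which $x_j=G(jB)$ is on this branch (i.e. $jB>1+\log L$), with $z_j=G(jB+L)-1$, the width $w_j=z_j-x_j$ equals $W(jB)$ and satisfies the strict bounds $$\frac1{L(z_j+1)-1}<w_j<\frac1{Lx_j-1}.$$ Moreover, $$w_j<1\quad\Longleftrightarrow\quad x_j>\frac2{e^L-1}=\frac2{C-1}.$$ If $\Delta a_j=a_{j+1}-a_j$, then throughout the discrete large-branch range $(-1)^n\Delta^nw_j>0$ for all $n\ge0$, and, for each fixed $n$, as $j\to\infty$, $$(-1)^n\Delta^nw_j=\frac{n!}{B j^{n+1}}+O_{c,b,n}\left(\frac{\log j}{j^{n+2}}\right).$$ Thus $(w_j)$ is strictly decreasing and strictly convex.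
   Context: $\{x\}=x-\lfloor x\rfloor$; $\log$ is the natural logarithm. The function $u\mapsto Lu-\log u$ is strictly increasing on $(1/L,\infty)$ with image $(1+\log L,\infty)$. Layers are indexed by integers $j$. Equivalently $x_j=-\frac1L W_{-1}(-Lb^{-j})$ and $z_j=-\frac1L W_{-1}(-\frac{L}{Cb^j})-1$, where $W_{-1}$ is the lower real branch of the Lambert function (not to be confused with the width function $W(J)$ above). *)

theory Defs
  imports "HOL-Analysis.Analysis" "HOL-Library.Landau_Symbols"
begin

definition fwd_diff :: "(int \<Rightarrow> real) \<Rightarrow> int \<Rightarrow> real" where
  "fwd_diff a j = a (j + 1) - a j"

(* Intended for index sets I without gaps, such as a half-line of integers. *)
definition strictly_convex_seq_on :: "int set \<Rightarrow> (int \<Rightarrow> real) \<Rightarrow> bool" where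
  "strictly_convex_seq_on I a \<longleftrightarrow>
     (\<forall>j. j \<in> I \<and> j + 2 \<in> I \<longrightarrow> 2 * a (j + 1) < a j + a (j + 2))"

(* The large branch of the inverse of u |-> L u - ln u.  For L > 0 it is meaningful only
   on {1 + ln L<..}, the image of {1/L<..}; elsewhere its value is unspecified. *)
definition large_branch_inv :: "real \<Rightarrow> real \<Rightarrow> real" where
  "large_branch_inv L = the_inv_into {1 / L<..} (\<lambda>u. L * u - ln u)"

end

theory Submission
  imports Defs "HOL-Computational_Algebra.Polynomial" "HOL-Real_Asymp.Real_Asymp"
begin

text \<open>
  Everything rests on the differential equation \<open>R' = - R\<^sup>2 (1 + R)\<close>. It follows from
  \<open>G' = G / (L G - 1) = (1 + R) / L\<close>, the derivative of an inverse function.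
  Iterating it gives \<open>R\<^sup>(\<^sup>n\<^sup>) = (-1)\<^sup>n P\<^sub>n(R)\<close> with polynomials \<open>P\<^sub>0 = X\<close>,
  \<open>P\<^sub>n\<^sub>+\<^sub>1 = (X\<^sup>2 + X\<^sup>3) P\<^sub>n'\<close>. They have nonnegative coefficients and lowest term
  \<open>n! X\<^sup>n\<^sup>+\<^sup>1\<close> (\<open>rate_poly_lowest_term\<close>). The signs of all derivatives of \<open>R\<close> come from the
  nonnegativity, and their size as \<open>R\<close> tends to \<open>0\<close> comes from the lowest term.

  The width is the step-\<open>L\<close> difference of \<open>S(J) = G(J) - J / L\<close>, whose derivative is \<open>R / L\<close>.
  This is the integral formula, and by the mean value theorem \<open>W\<^sup>(\<^sup>n\<^sup>)(J) = R\<^sup>(\<^sup>n\<^sup>)(\<eta>)\<close> for some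
  \<open>\<eta>\<close> strictly between \<open>J\<close> and \<open>J + L\<close> (\<open>width_deriv_mean_value\<close>). The case \<open>n = 0\<close> and the
  monotonicity of \<open>R\<close> enclose \<open>w\<^sub>j\<close> between two values of \<open>R\<close>. Each forward difference
  \<open>\<Delta>\<^sup>n w\<^sub>j\<close> samples \<open>W\<close> at spacing \<open>B\<close>, so it equals \<open>B\<^sup>n R\<^sup>(\<^sup>n\<^sup>)(\<eta>)\<close> for some \<open>\<eta>\<close> at bounded
  distance from \<open>j B\<close> (\<open>fwd_diff_width_mean_value\<close>). The signs are then immediate.

  For the asymptotics, \<open>1 / R(\<eta>) = L G - 1 = \<eta> + ln G - 1 = j B + O(ln j)\<close>, hence
  \<open>R(\<eta>) = 1 / (B j) + O(ln j / j\<^sup>2)\<close> (\<open>rate_asymptotics\<close>). Substituting this into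
  \<open>B\<^sup>n\<close> times the lowest term of \<open>P\<^sub>n\<close> gives \<open>n! / (B j\<^sup>n\<^sup>+\<^sup>1)\<close> with the required error; the remaining terms
  of \<open>P\<^sub>n\<close> contribute only \<open>O(1 / j\<^sup>n\<^sup>+\<^sup>2)\<close>.
\<close>

section \<open>Iterated differences and a mean value theorem\<close>

text \<open>
  The discrete counterpart of Taylor's mean value form. The induction replaces the whole tower
  of derivatives \<open>D\<close> by the tower of its differences \<open>D k (t + h) - D k t\<close>, which is again a tower
  of derivatives, and one application of the mean value theorem undoes the difference at the end.
\<close>

lemma fwd_diff_funpow_mean_value:
  fixes D :: "nat \<Rightarrow> real \<Rightarrow> real" and a h :: real
  assumes h: "h > 0"
    and D: "\<And>k t. t > a \<Longrightarrow> (D k has_real_derivative D (Suc k) t) (at t)"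
    and j: "of_int j * h > a"
  shows "\<exists>\<xi>. of_int j * h \<le> \<xi> \<and> \<xi> \<le> of_int j * h + of_nat n * h \<and>
           (fwd_diff ^^ n) (\<lambda>i. D 0 (of_int i * h)) j = h ^ n * D n \<xi>"
  using D
proof (induction n arbitrary: D)
  case 0
  show ?case by (rule exI[of _ "of_int j * h"]) simp
next
  case (Suc n)
  define E where "E = (\<lambda>k t. D k (t + h) - D k t)"
  have E: "(E k has_real_derivative E (Suc k) t) (at t)" if "t > a" for k t
    unfolding E_def using that h
    by (auto intro!: derivative_eq_intros Suc.prems DERIV_shift[THEN iffD1])
  obtain \<xi> where \<xi>: "of_int j * h \<le> \<xi>" "\<xi> \<le> of_int j * h + of_nat n * h"
      "(fwd_diff ^^ n) (\<lambda>i. E 0 (of_int i * h)) j = h ^ n * E n \<xi>"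
    using Suc.IH[of E, OF E] by blast
  have "\<exists>\<eta>. \<eta> > \<xi> \<and> \<eta> < \<xi> + h \<and> D n (\<xi> + h) - D n \<xi> = (\<xi> + h - \<xi>) * D (Suc n) \<eta>"
    using \<xi>(1) j h by (intro MVT2 Suc.prems) auto
  then obtain \<eta> where \<eta>: "\<eta> > \<xi>" "\<eta> < \<xi> + h" "E n \<xi> = h * D (Suc n) \<eta>"
    unfolding E_def by auto
  have "fwd_diff (\<lambda>i. D 0 (of_int i * h)) = (\<lambda>i. E 0 (of_int i * h))"
    by (auto simp: fwd_diff_def E_def algebra_simps)
  hence "(fwd_diff ^^ Suc n) (\<lambda>i. D 0 (of_int i * h)) j = h ^ Suc n * D (Suc n) \<eta>"
    using \<xi>(3) \<eta>(3) by (simp add: funpow_Suc_right del: funpow.simps)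
  thus ?case using \<xi>(1,2) \<eta>(1,2) by (intro exI[of _ \<eta>]) (auto simp: algebra_simps)
qed

text \<open>
  An explicit tower of derivatives identifies \<open>deriv ^^ n\<close>. The domain must be open, since each
  step differentiates an equation known only on the ray.
\<close>

lemma deriv_funpow_eq_on_ray:
  fixes D :: "nat \<Rightarrow> real \<Rightarrow> real" and a :: real
  assumes D: "\<And>k t. t > a \<Longrightarrow> (D k has_real_derivative D (Suc k) t) (at t)"
    and t: "t > a"
  shows "((deriv ^^ n) (D 0) has_real_derivative D (Suc n) t) (at t)"
    and "(deriv ^^ n) (D 0) t = D n t"
proof -
  have *: "\<forall>t>a. (deriv ^^ n) (D 0) t = D n t"
  proof (induction n)
    case (Suc n)
    have "((deriv ^^ n) (D 0) has_real_derivative D (Suc n) t) (at t)" if "t > a" for t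
      by (rule has_field_derivative_transform_within_open[OF D, where S = "{a<..}"])
         (use that Suc in auto)
    thus ?case by (auto intro: DERIV_imp_deriv)
  qed auto
  thus "(deriv ^^ n) (D 0) t = D n t" using t by blast
  show "((deriv ^^ n) (D 0) has_real_derivative D (Suc n) t) (at t)"
    by (rule has_field_derivative_transform_within_open[OF D, where S = "{a<..}"])
       (use t * in auto)
qed

section \<open>The large branch\<close>

text \<open>
  The tangent bound gives \<open>ln v - ln u < v / u - 1 = (v - u) / u\<close>, and \<open>1 / u \<le> L\<close> on this range.
\<close>

lemma large_branch_strict_mono:
  fixes L :: real
  assumes L: "L > 0" and u: "1 / L \<le> u" "u < v"
  shows "L * u - ln u < L * v - ln v"
proof -
  have u0: "u > 0" using L u(1) by (metis less_le_trans zero_less_divide_1_iff)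
  have "ln v - ln u = ln (v / u)" using u0 u by (simp add: ln_div)
  also have "\<dots> < v / u - 1"
    using u0 u ln_add_one_self_less_self[of "v / u - 1"] by simp
  also have "\<dots> = (v - u) * (1 / u)" using u0 by (simp add: field_simps)
  also have "\<dots> \<le> (v - u) * L"
    using u0 u L by (intro mult_left_mono) (auto simp: field_simps)
  finally show ?thesis by (simp add: algebra_simps)
qed

lemma large_branch_inj:
  fixes L :: real
  assumes L: "L > 0"
  shows "inj_on (\<lambda>u. L * u - ln u) {1 / L<..}"
proof (rule linorder_inj_onI')
  fix u v :: real
  assume "u \<in> {1 / L<..}" "v \<in> {1 / L<..}" "u < v"
  thus "L * u - ln u \<noteq> L * v - ln v"
    using large_branch_strict_mono[OF L, of u v] by auto
qed

text \<open>
  The value \<open>J\<close> is attained by the intermediate value theorem: the function equals \<open>1 + ln L\<close> at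
  \<open>1 / L\<close> and tends to infinity.
\<close>

lemma large_branch_inv:
  fixes L J :: real
  assumes L: "L > 0" and J: "J > 1 + ln L"
  shows "large_branch_inv L J > 1 / L"
    and "L * large_branch_inv L J - ln (large_branch_inv L J) = J"
proof -
  let ?F = "\<lambda>u::real. L * u - ln u"
  have inj: "inj_on ?F {1/L<..}"
    by (rule large_branch_inj[OF L])
  have lim: "filterlim ?F at_top at_top"
    using L by real_asymp
  obtain v where v: "v > 1 / L" "?F v \<ge> J"
    using eventually_conj[OF eventually_gt_at_top[of "1/L"]
        lim[unfolded filterlim_at_top, rule_format, of J]]
    by (auto simp: eventually_at_top_linorder)
  have F0: "?F (1/L) = 1 + ln L" using L by (simp add: ln_div)
  have "\<exists>u\<ge>1/L. u \<le> v \<and> ?F u = J"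
    using v J F0 L
    by (intro IVT')
       (auto intro!: continuous_intros simp: less_le_trans[of 0 "1/L"])
  then obtain u where u: "u \<ge> 1/L" "?F u = J" by blast
  with F0 J have "u > 1 / L" by (cases "u = 1/L") auto
  hence "J \<in> ?F ` {1/L<..}" using u by auto
  from f_the_inv_into_f[OF inj this] the_inv_into_into[OF inj this order_refl]
  show "large_branch_inv L J > 1 / L"
    and "L * large_branch_inv L J - ln (large_branch_inv L J) = J"
    by (auto simp: large_branch_inv_def)
qed

lemma large_branch_inv_unique:
  fixes L u :: real
  assumes L: "L > 0" and u: "u > 1 / L"
  shows "large_branch_inv L (L * u - ln u) = u"
proof -
  have "inj_on (\<lambda>u::real. L * u - ln u) {1/L<..}"
    by (rule large_branch_inj[OF L])
  from the_inv_into_f_f[OF this] u show ?thesis by (simp add: large_branch_inv_def)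
qed

definition rate :: "real \<Rightarrow> real \<Rightarrow> real" where
  "rate L J = 1 / (L * large_branch_inv L J - 1)"

lemma rate_pos:
  assumes "L > 0" "J > 1 + ln L"
  shows "rate L J > 0"
  using large_branch_inv(1)[OF assms] assms(1) by (simp add: rate_def field_simps)

lemma DERIV_large_branch_inv:
  fixes L J :: real
  assumes L: "L > 0" and J: "J > 1 + ln L"
  shows "(large_branch_inv L has_real_derivative (1 + rate L J) / L) (at J)"
proof -
  let ?G = "large_branch_inv L"
  let ?F = "\<lambda>u::real. L * u - ln u"
  note G = large_branch_inv[OF L J]
  have pos: "?G J > 0" using G(1) L by (metis less_trans zero_less_divide_1_iff)
  have "isCont ?G (?F (?G J))"
  \<comment> \<open>The midpoint of \<open>1 / L\<close> and \<open>G J\<close> keeps a closed neighbourhood of \<open>G J\<close> inside the branch.\<close>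
  proof (rule isCont_inverse_function2[where f = ?F and a = "(1 / L + ?G J) / 2" and b = "?G J + 1"])
    show "\<And>z. (1 / L + ?G J) / 2 \<le> z \<Longrightarrow> z \<le> ?G J + 1 \<Longrightarrow> ?G (?F z) = z"
      using G(1) by (intro large_branch_inv_unique L) (simp add: field_simps)
    show "isCont ?F z" if "(1 / L + ?G J) / 2 \<le> z" "z \<le> ?G J + 1" for z
    proof -
      have "0 < (1 / L + ?G J) / 2" using L pos by (intro divide_pos_pos add_pos_pos) auto
      hence "z \<noteq> 0" using that by linarith
      thus ?thesis by (auto intro!: continuous_intros)
    qed
  qed (use G(1) in auto)
  hence cont: "isCont ?G J" using G(2) by simp
  have "(?G has_real_derivative inverse (L - 1 / ?G J)) (at J)"
  proof (rule DERIV_inverse_function[of ?F])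
    show "(?F has_real_derivative L - 1 / ?G J) (at (?G J))"
      using pos by (auto intro!: derivative_eq_intros)
    show "L - 1 / ?G J \<noteq> 0" using G(1) pos L by (auto simp: field_simps)
    show "1 + ln L < J" "J < J + 1" using J by auto
    show "\<And>y. 1 + ln L < y \<Longrightarrow> y < J + 1 \<Longrightarrow> ?F (?G y) = y"
      using large_branch_inv(2)[OF L] by auto
  qed (rule cont)
  also have "inverse (L - 1 / ?G J) = (1 + rate L J) / L"
  proof -
    have "L * ?G J - 1 > 0" using G(1) L by (simp add: field_simps)
    thus ?thesis using pos L by (simp add: rate_def divide_simps)
  qed
  finally show ?thesis .
qed

lemma DERIV_rate:
  fixes L J :: real
  assumes L: "L > 0" and J: "J > 1 + ln L"
  shows "(rate L has_real_derivative - (rate L J)\<^sup>2 * (1 + rate L J)) (at J)"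
proof -
  have *: "L * large_branch_inv L J - 1 > 0"
    using large_branch_inv(1)[OF L J] L by (simp add: field_simps)
  have "((\<lambda>J. 1 / (L * large_branch_inv L J - 1)) has_real_derivative
          - (rate L J)\<^sup>2 * (1 + rate L J)) (at J)"
    using * L
    by (auto intro!: derivative_eq_intros DERIV_large_branch_inv[OF L J])
       (simp add: rate_def power2_eq_square divide_simps)
  thus ?thesis by (simp add: rate_def[abs_def])
qed

section \<open>All derivatives of the rate\<close>

text \<open>
  The signless derivatives of the rate as polynomials in the rate: by the chain rule,
  differentiating \<open>P(R)\<close> gives \<open>- P'(R) R\<^sup>2 (1 + R)\<close>.
\<close>

fun rate_poly :: "nat \<Rightarrow> real poly" where
  "rate_poly 0 = [:0, 1:]"
| "rate_poly (Suc n) = [:0, 0, 1, 1:] * pderiv (rate_poly n)"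

definition rate_deriv :: "real \<Rightarrow> nat \<Rightarrow> real \<Rightarrow> real" where
  "rate_deriv L n J = (- 1) ^ n * poly (rate_poly n) (rate L J)"

lemma rate_deriv_0: "rate_deriv L 0 = rate L"
  by (auto simp: rate_deriv_def)

lemma DERIV_rate_deriv:
  assumes L: "L > 0" and J: "J > 1 + ln L"
  shows "(rate_deriv L n has_real_derivative rate_deriv L (Suc n) J) (at J)"
proof -
  have "((\<lambda>J. (- 1) ^ n * poly (rate_poly n) (rate L J)) has_real_derivative
      (- 1) ^ n * (poly (pderiv (rate_poly n)) (rate L J) * (- (rate L J)\<^sup>2 * (1 + rate L J)))) (at J)"
    by (intro DERIV_cmult DERIV_chain2[OF poly_DERIV] DERIV_rate L J)
  thus ?thesis
    by (simp add: rate_deriv_def[abs_def] algebra_simps power2_eq_square)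
qed

text \<open>
  If \<open>P = n! X\<^sup>n\<^sup>+\<^sup>1 + X\<^sup>n\<^sup>+\<^sup>2 Q\<close>, then \<open>P' = (n + 1)! X\<^sup>n + X\<^sup>n\<^sup>+\<^sup>1 T\<close> with \<open>T = (n + 2) Q + X Q'\<close>,
  and multiplying by \<open>X\<^sup>2 (1 + X)\<close> reproduces the shape with
  \<open>(n + 1)! + (1 + X) T\<close> in place of \<open>Q\<close>. No subtraction occurs, so signs are preserved.
\<close>

lemma rate_poly_lowest_term:
  "\<exists>Q. (\<forall>i. coeff Q i \<ge> 0) \<and>
       rate_poly n = monom (fact n) (n + 1) + monom 1 (n + 2) * Q"
proof (induction n)
  case 0
  show ?case by (rule exI[of _ 0]) (simp add: monom_altdef)
next
  case (Suc n)
  then obtain Q where Q: "\<And>i. coeff Q i \<ge> 0"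
      "rate_poly n = monom (fact n) (n + 1) + monom 1 (n + 2) * Q" by blast
  define T where "T = smult (of_nat (n + 2)) Q + [:0, 1:] * pderiv Q"
  define Q' where "Q' = [:fact (Suc n):] + [:1, 1:] * T"
  have T: "coeff T i \<ge> 0" for i
    using Q(1) by (auto simp: T_def coeff_pderiv coeff_pCons split: nat.splits)
  have Q': "coeff Q' i \<ge> 0" for i
    using T by (auto simp: Q'_def coeff_pCons split: nat.splits intro!: add_nonneg_nonneg)
  have "rate_poly (Suc n) = monom (fact (Suc n)) (Suc n + 1) + monom 1 (Suc n + 2) * Q'"
  proof -
    have "poly (rate_poly (Suc n)) r =
        poly (monom (fact (Suc n)) (Suc n + 1) + monom 1 (Suc n + 2) * Q') r" for r
      by (simp add: Q(2) Q'_def T_def poly_monom pderiv_add pderiv_mult pderiv_monom algebra_simps)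
    thus ?thesis by (subst poly_eq_poly_eq_iff[symmetric]) blast
  qed
  with Q' show ?case by blast
qed


lemma rate_deriv_expansion:
  "\<exists>Q. (\<forall>i. coeff Q i \<ge> 0) \<and>
       (\<forall>L J. (- 1) ^ n * rate_deriv L n J =
          fact n * rate L J ^ (n + 1) + rate L J ^ (n + 2) * poly Q (rate L J))"
proof -
  obtain Q where Q: "\<forall>i. coeff Q i \<ge> 0"
      "rate_poly n = monom (fact n) (n + 1) + monom 1 (n + 2) * Q"
    using rate_poly_lowest_term by blast
  have "(- 1) ^ n * rate_deriv L n J = poly (rate_poly n) (rate L J)" for L J
    by (simp add: rate_deriv_def flip: mult.assoc power_mult_distrib)
  with Q show ?thesis by (intro exI[of _ Q]) (auto simp: poly_monom)
qed

lemma rate_deriv_alternates: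
  assumes L: "L > 0" and J: "J > 1 + ln L"
  shows "(- 1) ^ n * rate_deriv L n J > 0"
proof -
  obtain Q where Q: "\<And>i. coeff Q i \<ge> 0"
      "(- 1) ^ n * rate_deriv L n J =
          fact n * rate L J ^ (n + 1) + rate L J ^ (n + 2) * poly Q (rate L J)"
    using rate_deriv_expansion by blast
  note r = rate_pos[OF L J]
  have "poly Q (rate L J) \<ge> 0"
    unfolding poly_altdef using Q(1) r by (intro sum_nonneg) auto
  thus ?thesis unfolding Q(2) using r by (intro add_pos_nonneg) auto
qed

section \<open>The width as a difference\<close>

text \<open>
  The tower of derivatives that starts with \<open>S(J) = G(J) - J / L\<close>. Subtracting \<open>J / L\<close> makes the
  constant \<open>-1\<close> in the width part of the difference \<open>S(J + L) - S(J)\<close>, and cancels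
  the constant in \<open>G' = (1 + R) / L\<close>.
\<close>

fun width_prim :: "real \<Rightarrow> nat \<Rightarrow> real \<Rightarrow> real" where
  "width_prim L 0 J = large_branch_inv L J - J / L"
| "width_prim L (Suc n) J = rate_deriv L n J / L"

definition width_deriv :: "real \<Rightarrow> nat \<Rightarrow> real \<Rightarrow> real" where
  "width_deriv L n J = width_prim L n (J + L) - width_prim L n J"

lemma DERIV_width_prim:
  assumes L: "L > 0" and J: "J > 1 + ln L"
  shows "(width_prim L n has_real_derivative rate_deriv L n J / L) (at J)"
proof (cases n)
  case 0
  have "((\<lambda>J. large_branch_inv L J - J / L) has_real_derivative
           (1 + rate L J) / L - 1 / L) (at J)"
    using L by (auto intro!: derivative_eq_intros DERIV_large_branch_inv J)
  moreover have "width_prim L 0 = (\<lambda>J. large_branch_inv L J - J / L)"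
    by auto
  ultimately show ?thesis
    using 0 by (simp add: rate_deriv_0 add_divide_distrib)
next
  case (Suc k)
  have "width_prim L (Suc k) = (\<lambda>J. rate_deriv L k J / L)" by auto
  thus ?thesis using Suc DERIV_cdivide[OF DERIV_rate_deriv[OF L J]] by simp
qed

lemma width_deriv_0:
  assumes "L > 0"
  shows "width_deriv L 0 J = large_branch_inv L (J + L) - large_branch_inv L J - 1"
  using assms by (simp add: width_deriv_def add_divide_distrib)

lemma DERIV_width_deriv:
  assumes L: "L > 0" and J: "J > 1 + ln L"
  shows "(width_deriv L n has_real_derivative width_deriv L (Suc n) J) (at J)"
proof -
  have "((\<lambda>J. width_prim L n (J + L) - width_prim L n J) has_real_derivative
          rate_deriv L n (J + L) / L - rate_deriv L n J / L) (at J)"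
    using L J by (intro DERIV_diff DERIV_shift[THEN iffD1] DERIV_width_prim) auto
  thus ?thesis by (simp add: width_deriv_def[abs_def])
qed

text \<open>
  The step of the difference is \<open>L\<close> and the derivative carries the factor \<open>1 / L\<close>, so the two cancel.
\<close>

lemma width_deriv_mean_value:
  assumes L: "L > 0" and J: "J > 1 + ln L"
  obtains \<eta> where "J < \<eta>" "\<eta> < J + L" "width_deriv L n J = rate_deriv L n \<eta>"
proof -
  have "\<exists>\<eta>. \<eta> > J \<and> \<eta> < J + L \<and>
      width_prim L n (J + L) - width_prim L n J = (J + L - J) * (rate_deriv L n \<eta> / L)"
    using L J by (intro MVT2 DERIV_width_prim) auto
  with that L show ?thesis by (auto simp: width_deriv_def)
qed

lemma width_deriv_alternates:
  assumes L: "L > 0" and J: "J > 1 + ln L"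
  shows "(- 1) ^ n * width_deriv L n J > 0"
  using width_deriv_mean_value[OF L J, of n] rate_deriv_alternates[OF L, of _ n] J
  by (metis less_trans)

text \<open>
  Two mean value theorems in succession: one for the \<open>n\<close> differences of step \<open>B\<close>, one for the
  difference of step \<open>L\<close> hidden in the width.
\<close>

lemma fwd_diff_width_mean_value:
  assumes L: "L > 0" and B: "B > 0" and j: "of_int j * B > 1 + ln L"
  shows "\<exists>\<eta>. of_int j * B < \<eta> \<and> \<eta> < of_int j * B + (of_nat n * B + L) \<and>
    (fwd_diff ^^ n) (\<lambda>i. width_deriv L 0 (of_int i * B)) j = B ^ n * rate_deriv L n \<eta>"
proof -
  obtain \<xi> where \<xi>: "of_int j * B \<le> \<xi>" "\<xi> \<le> of_int j * B + of_nat n * B"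
      "(fwd_diff ^^ n) (\<lambda>i. width_deriv L 0 (of_int i * B)) j = B ^ n * width_deriv L n \<xi>"
    using fwd_diff_funpow_mean_value[of B "1 + ln L" "width_deriv L", OF B DERIV_width_deriv[OF L] j]
    by blast
  obtain \<eta> where "\<xi> < \<eta>" "\<eta> < \<xi> + L" "width_deriv L n \<xi> = rate_deriv L n \<eta>"
    using width_deriv_mean_value[OF L, of \<xi> n] \<xi>(1) j by auto
  with \<xi> show ?thesis by (intro exI[of _ \<eta>]) auto
qed

lemma rate_strict_antimono:
  assumes L: "L > 0" and "J > 1 + ln L" "J < J'"
  shows "rate L J' < rate L J"
proof (rule DERIV_neg_imp_decreasing[OF assms(3)])
  fix t assume "J \<le> t" "t \<le> J'"
  hence t: "t > 1 + ln L" using assms by auto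
  show "\<exists>y. (rate L has_real_derivative y) (at t) \<and> y < 0"
    using DERIV_rate[OF L t] rate_pos[OF L t]
    by (intro exI[of _ "- (rate L t)\<^sup>2 * (1 + rate L t)"]) (auto simp: mult_pos_pos)
qed

lemma width_between_rates:
  assumes L: "L > 0" and J: "J > 1 + ln L"
  shows "rate L (J + L) < width_deriv L 0 J" "width_deriv L 0 J < rate L J"
proof -
  obtain \<eta> where "J < \<eta>" "\<eta> < J + L" "width_deriv L 0 J = rate L \<eta>"
    using width_deriv_mean_value[OF L J, of 0] by (auto simp: rate_deriv_0)
  thus "rate L (J + L) < width_deriv L 0 J" "width_deriv L 0 J < rate L J"
    using rate_strict_antimono[OF L] J by auto
qed

lemma rate_has_integral_width:
  assumes L: "L > 0" and J: "J > 1 + ln L"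
  shows "(rate L has_integral (L * width_deriv L 0 J)) {J..J + L}"
proof -
  have "(rate L has_integral (L * width_prim L 0 (J + L) - L * width_prim L 0 J)) {J..J + L}"
  proof (rule fundamental_theorem_of_calculus)
    fix t assume "t \<in> {J..J + L}"
    hence t: "t > 1 + ln L" using J by auto
    have "((\<lambda>t. L * width_prim L 0 t) has_real_derivative L * (rate_deriv L 0 t / L)) (at t)"
      by (intro DERIV_cmult DERIV_width_prim L t)
    thus "((\<lambda>t. L * width_prim L 0 t) has_vector_derivative rate L t) (at t within {J..J + L})"
      using L by (simp add: rate_deriv_0 has_real_derivative_iff_has_vector_derivative
                            has_vector_derivative_at_within)
  qed (use L in auto)
  thus ?thesis by (simp add: width_deriv_def right_diff_distrib)
qed

text \<open>
  Write \<open>u = G(J)\<close> and \<open>v = G(J + L)\<close>. The condition is \<open>v < u + 2\<close>. The increasing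
  function \<open>t \<mapsto> L t - ln t\<close> turns it into \<open>ln ((u + 2) / u) < L\<close>, in which \<open>v\<close> no longer occurs.
\<close>

lemma width_less_one_iff:
  assumes L: "L > 0" and J: "J > 1 + ln L"
  shows "width_deriv L 0 J < 1 \<longleftrightarrow> large_branch_inv L J > 2 / (exp L - 1)"
proof -
  define u where "u = large_branch_inv L J"
  define v where "v = large_branch_inv L (J + L)"
  have J': "J + L > 1 + ln L" using J L by simp
  have u: "u > 1 / L" "L * u - ln u = J" and v: "v > 1 / L" "L * v - ln v = J + L"
    using large_branch_inv[OF L J] large_branch_inv[OF L J'] by (auto simp: u_def v_def)
  have u0: "u > 0" using u(1) L by (metis less_trans zero_less_divide_1_iff)
  have "width_deriv L 0 J < 1 \<longleftrightarrow> v < u + 2"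
    using L by (auto simp: width_deriv_0 u_def v_def)
  also have "\<dots> \<longleftrightarrow> L * v - ln v < L * (u + 2) - ln (u + 2)"
    using large_branch_strict_mono[OF L, of v "u + 2"]
          large_branch_strict_mono[OF L, of "u + 2" v] u(1) v(1)
    by (cases v "u + 2" rule: linorder_cases) auto
  also have "\<dots> \<longleftrightarrow> ln ((u + 2) / u) < L"
    using u v(2) u0 by (auto simp: ln_div algebra_simps)
  also have "\<dots> \<longleftrightarrow> (u + 2) / u < exp L"
    using u0 by (metis exp_less_cancel_iff exp_ln add_pos_pos divide_pos_pos zero_less_numeral)
  also have "\<dots> \<longleftrightarrow> u > 2 / (exp L - 1)"
    using u0 L by (simp add: field_simps)
  finally show ?thesis by (simp add: u_def)
qed

section \<open>Asymptotics\<close>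

text \<open>
  Induction on \<open>f\<^sup>n\<^sup>+\<^sup>2 - g\<^sup>n\<^sup>+\<^sup>2 = f (f\<^sup>n\<^sup>+\<^sup>1 - g\<^sup>n\<^sup>+\<^sup>1) + g\<^sup>n\<^sup>+\<^sup>1 (f - g)\<close>.
\<close>

lemma bigo_power_diff:
  fixes f g h e :: "'a \<Rightarrow> real"
  assumes f: "f \<in> O[F](h)" and g: "g \<in> O[F](h)" and e: "(\<lambda>x. f x - g x) \<in> O[F](e)"
  shows "(\<lambda>x. f x ^ (n + 1) - g x ^ (n + 1)) \<in> O[F](\<lambda>x. h x ^ n * e x)"
proof (induction n)
  case 0
  show ?case using e by simp
next
  case (Suc n)
  have "(\<lambda>x. f x * (f x ^ (n + 1) - g x ^ (n + 1))) \<in> O[F](\<lambda>x. h x * (h x ^ n * e x))"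
    by (rule landau_o.big.mult[OF f Suc])
  moreover have "(\<lambda>x. g x ^ (n + 1) * (f x - g x)) \<in> O[F](\<lambda>x. h x ^ (n + 1) * e x)"
    by (rule landau_o.big.mult[OF landau_o.big_power[OF g] e])
  ultimately have "(\<lambda>x. f x * (f x ^ (n + 1) - g x ^ (n + 1)) + g x ^ (n + 1) * (f x - g x))
      \<in> O[F](\<lambda>x. h x ^ (n + 1) * e x)"
    by (intro sum_in_bigo) (auto simp: mult_ac)
  thus ?case by (simp add: algebra_simps)
qed

text \<open>
  The upper bound absorbs the logarithm into half of the linear term: \<open>ln x \<le> x - 1\<close> at
  \<open>x = L u / 2\<close> gives \<open>ln u \<le> L u / 2 - 1 - ln (L / 2)\<close>. It shows that \<open>G\<close> grows at most
  linearly, hence that \<open>ln G(J)\<close> is \<open>O(ln J)\<close>.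
\<close>

lemma large_branch_inv_ln_bounds:
  assumes L: "L > 0" and J: "J > 1 + ln L"
  shows "- ln L \<le> ln (large_branch_inv L J)"
    and "large_branch_inv L J \<le> 2 / L * (J - 1 - ln (L / 2))"
proof -
  define u where "u = large_branch_inv L J"
  have u: "u > 1 / L" "L * u - ln u = J"
    using large_branch_inv[OF L J] by (auto simp: u_def)
  have u0: "u > 0" using u(1) L by (metis less_trans zero_less_divide_1_iff)
  have "ln (1 / L) \<le> ln u" using u(1) L u0 by simp
  thus "- ln L \<le> ln u" using L by (simp add: ln_div)
  have "ln (L / 2 * u) \<le> L / 2 * u - 1" using L u0 by (intro ln_le_minus_one) auto
  hence "ln u \<le> L / 2 * u - 1 - ln (L / 2)"
    using L u0 by (subst (asm) ln_mult_pos) auto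
  with u(2) show "u \<le> 2 / L * (J - 1 - ln (L / 2))"
    using L by (simp add: field_simps)
qed

text \<open>
  The reciprocal of the rate is \<open>L G - 1 = \<eta> + ln G - 1\<close>, which differs from \<open>B j\<close> by some
  \<open>d = O(ln j)\<close>. Passing to reciprocals, \<open>R - 1 / (B j) = - d R / (B j)\<close>.
\<close>

lemma rate_asymptotics:
  fixes \<eta> :: "int \<Rightarrow> real"
  assumes L: "L > 0" and B: "B > 0"
    and \<eta>: "\<forall>\<^sub>F j in at_top. of_int j * B \<le> \<eta> j \<and> \<eta> j \<le> of_int j * B + K"
  shows "(\<lambda>j. rate L (\<eta> j)) \<in> O[at_top](\<lambda>j. 1 / of_int j)"
    and "(\<lambda>j. rate L (\<eta> j) - 1 / (B * of_int j)) \<in> O[at_top](\<lambda>j. ln (of_int j) / of_int j ^ 2)"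
proof -
  define K' where "K' = 2 / L * (K - 1 - ln (L / 2))"
  define d where "d = (\<lambda>j. L * large_branch_inv L (\<eta> j) - 1 - B * of_int j)"
  have int_top: "filterlim (\<lambda>j::int. real_of_int j) at_top at_top"
    by (rule filterlim_real_of_int_at_top)
  have "\<forall>\<^sub>F x in at_top. x * B > 1 + ln L \<and> B * x - ln L - 1 > 0 \<and> x > 0"
    using B by (intro eventually_conj) real_asymp+
  hence large: "\<forall>\<^sub>F j::int in at_top. of_int j * B > 1 + ln L \<and> B * of_int j - ln L - 1 > 0
                   \<and> real_of_int j > 0"
    using int_top by (rule eventually_compose_filterlim)
  have "(\<lambda>x. 1 / (B * x - ln L - 1)) \<in> O(\<lambda>x::real. 1 / x)"
    using B by real_asymp
  hence lower: "(\<lambda>j. 1 / (B * of_int j - ln L - 1)) \<in> O[at_top](\<lambda>j::int. 1 / of_int j)"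
    using int_top by (rule landau_o.big.compose)
  have "2 / L * B > 0" using L B by simp
  hence "(\<lambda>x. \<bar>K\<bar> + 1 + \<bar>ln L\<bar> + \<bar>ln (2 / L * B * x + K')\<bar>) \<in> O(\<lambda>x::real. ln x)"
    by real_asymp
  hence upper: "(\<lambda>j. \<bar>K\<bar> + 1 + \<bar>ln L\<bar> + \<bar>ln (2 / L * B * of_int j + K')\<bar>)
      \<in> O[at_top](\<lambda>j::int. ln (of_int j))"
    using int_top by (rule landau_o.big.compose)
  have bounds: "\<forall>\<^sub>F j in at_top.
      0 < B * of_int j - ln L - 1 \<and> 0 < rate L (\<eta> j) \<and> rate L (\<eta> j) \<le> 1 / (B * of_int j - ln L - 1) \<and>
      \<bar>d j\<bar> \<le> \<bar>K\<bar> + 1 + \<bar>ln L\<bar> + \<bar>ln (2 / L * B * of_int j + K')\<bar> \<and>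
      rate L (\<eta> j) - 1 / (B * of_int j) = - d j * (rate L (\<eta> j) * (1 / (B * of_int j)))"
    using \<eta> large
  proof eventually_elim
    case (elim j)
    define u where "u = large_branch_inv L (\<eta> j)"
    have ht: "\<eta> j > 1 + ln L" using elim by auto
    have u: "u > 1 / L" "L * u - ln u = \<eta> j" "- ln L \<le> ln u"
        "u \<le> 2 / L * (\<eta> j - 1 - ln (L / 2))"
      using large_branch_inv[OF L ht] large_branch_inv_ln_bounds[OF L ht]
      by (auto simp: u_def)
    have u0: "u > 0" using u(1) L by (metis less_trans zero_less_divide_1_iff)
    have r: "rate L (\<eta> j) = 1 / (L * u - 1)" by (simp add: rate_def u_def)
    have pos: "L * u - 1 > 0" using u(1) L by (simp add: field_simps)
    have 1: "B * of_int j - ln L - 1 \<le> L * u - 1"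
      using u(2,3) elim by (simp add: mult.commute)
    have "u \<le> 2 / L * (of_int j * B + K - 1 - ln (L / 2))"
      using L elim by (intro order.trans[OF u(4)] mult_left_mono) auto
    also have "\<dots> = 2 / L * B * of_int j + K'"
      by (simp add: K'_def algebra_simps)
    finally have "ln u \<le> ln (2 / L * B * of_int j + K')" using u0 by simp
    moreover have "d j = \<eta> j - of_int j * B + ln u - 1"
      using u(2) by (simp add: d_def u_def mult.commute)
    ultimately have 2: "\<bar>d j\<bar> \<le> \<bar>K\<bar> + 1 + \<bar>ln L\<bar> + \<bar>ln (2 / L * B * of_int j + K')\<bar>"
      using u(3) elim by linarith
    have "rate L (\<eta> j) - 1 / (B * of_int j) = - d j * (rate L (\<eta> j) * (1 / (B * of_int j)))"
      using pos B elim by (simp add: r d_def u_def[symmetric] divide_simps)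
    with 1 2 pos elim show ?case by (auto simp: r intro!: divide_left_mono)
  qed
  have "(\<lambda>j. rate L (\<eta> j)) \<in> O[at_top](\<lambda>j. 1 / (B * of_int j - ln L - 1))"
    by (intro landau_o.big_mono eventually_mono[OF bounds]) auto
  with lower show r: "(\<lambda>j. rate L (\<eta> j)) \<in> O[at_top](\<lambda>j. 1 / of_int j)"
    by (rule landau_o.big.trans[rotated])
  have "d \<in> O[at_top](\<lambda>j. \<bar>K\<bar> + 1 + \<bar>ln L\<bar> + \<bar>ln (2 / L * B * of_int j + K')\<bar>)"
    by (intro landau_o.big_mono eventually_mono[OF bounds]) auto
  with upper have d: "(\<lambda>j. - d j) \<in> O[at_top](\<lambda>j. ln (of_int j))"
    using landau_o.big.trans by auto
  have "(\<lambda>j::int. 1 / B * (1 / real_of_int j)) \<in> O[at_top](\<lambda>j. 1 / of_int j)"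
    using B by (subst landau_o.big.cmult_in_iff) auto
  hence q: "(\<lambda>j. 1 / (B * of_int j)) \<in> O[at_top](\<lambda>j::int. 1 / of_int j)"
    by simp
  have "(\<lambda>j. - d j * (rate L (\<eta> j) * (1 / (B * of_int j))))
      \<in> O[at_top](\<lambda>j. ln (of_int j) * (1 / of_int j * (1 / of_int j)))"
    by (intro landau_o.big.mult d r q)
  also have "(\<lambda>j. ln (of_int j) * (1 / of_int j * (1 / of_int j))) =
      (\<lambda>j::int. ln (of_int j) / (of_int j ^ 2 :: real))"
    by (simp add: power2_eq_square)
  finally show "(\<lambda>j. rate L (\<eta> j) - 1 / (B * of_int j))
      \<in> O[at_top](\<lambda>j. ln (of_int j) / of_int j ^ 2)"
    by (rule landau_o.big.in_cong[THEN iffD2, rotated])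
       (rule eventually_mono[OF bounds], auto)
qed

lemma fwd_diff_width_asymptotics:
  assumes L: "L > 0" and B: "B > 0"
  shows "(\<lambda>j. (- 1) ^ n * (fwd_diff ^^ n) (\<lambda>i. width_deriv L 0 (of_int i * B)) j
              - fact n / (B * of_int j ^ (n + 1)))
           \<in> O[at_top](\<lambda>j. ln (of_int j) / of_int j ^ (n + 2))"
proof -
  define g where "g = (fwd_diff ^^ n) (\<lambda>i. width_deriv L 0 (of_int i * B))"
  have "\<forall>j. \<exists>\<eta>. of_int j * B > 1 + ln L \<longrightarrow>
      of_int j * B < \<eta> \<and> \<eta> < of_int j * B + (of_nat n * B + L) \<and> g j = B ^ n * rate_deriv L n \<eta>"
    unfolding g_def using fwd_diff_width_mean_value[OF L B] by blast
  then obtain \<eta> where \<eta>: "\<And>j. of_int j * B > 1 + ln L \<Longrightarrow>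
      of_int j * B < \<eta> j \<and> \<eta> j < of_int j * B + (of_nat n * B + L) \<and>
      g j = B ^ n * rate_deriv L n (\<eta> j)"
    by metis
  have int_top: "filterlim (\<lambda>j::int. real_of_int j) at_top at_top"
    by (rule filterlim_real_of_int_at_top)
  have "\<forall>\<^sub>F x in at_top. x * B > 1 + ln L \<and> x > 0"
    using B by (intro eventually_conj) real_asymp+
  hence large: "\<forall>\<^sub>F j::int in at_top. of_int j * B > 1 + ln L \<and> real_of_int j > 0"
    using int_top by (rule eventually_compose_filterlim)
  define r where "r = (\<lambda>j. rate L (\<eta> j))"
  define q where "q = (\<lambda>j::int. 1 / (B * real_of_int j))"
  have near: "\<forall>\<^sub>F j in at_top. of_int j * B \<le> \<eta> j \<and> \<eta> j \<le> of_int j * B + (of_nat n * B + L)"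
    using large by eventually_elim (use \<eta> in force)
  have r1: "r \<in> O[at_top](\<lambda>j. 1 / of_int j)"
    unfolding r_def by (rule rate_asymptotics(1)[OF L B near])
  have r2: "(\<lambda>j. r j - q j) \<in> O[at_top](\<lambda>j. ln (of_int j) / of_int j ^ 2)"
    unfolding r_def q_def by (rule rate_asymptotics(2)[OF L B near])
  have "(\<lambda>j::int. 1 / B * (1 / real_of_int j)) \<in> O[at_top](\<lambda>j. 1 / of_int j)"
    using B by (subst landau_o.big.cmult_in_iff) auto
  hence q: "q \<in> O[at_top](\<lambda>j. 1 / of_int j)"
    by (simp add: q_def)
  obtain Q where Q: "\<And>L J. (- 1) ^ n * rate_deriv L n J =
          fact n * rate L J ^ (n + 1) + rate L J ^ (n + 2) * poly Q (rate L J)"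
    using rate_deriv_expansion by blast
  have inv_le: "(\<lambda>j. 1 / real_of_int j ^ (n + 2)) \<in> O[at_top](\<lambda>j::int. ln (of_int j) / of_int j ^ (n + 2))"
    by (rule landau_o.big.compose[OF _ int_top, of "\<lambda>x. 1 / x ^ (n + 2)" "\<lambda>x. ln x / x ^ (n + 2)"]) real_asymp
  \<comment> \<open>Beyond its lowest term the polynomial only matters near \<open>0\<close>, where it is bounded.\<close>
  have r_lim: "(r \<longlongrightarrow> 0) at_top"
  proof -
    have "(\<lambda>j::int. 1 / real_of_int j) \<in> o[at_top](\<lambda>_. 1)"
      by (rule landau_o.small.compose[OF _ int_top, of "\<lambda>x. 1 / x"]) real_asymp
    with r1 have "r \<in> o[at_top](\<lambda>_. 1)" by (rule landau_o.big_small_trans)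
    thus ?thesis using smalloD_tendsto by force
  qed
  hence "((\<lambda>j. poly Q (r j)) \<longlongrightarrow> poly Q 0) at_top"
    by (intro tendsto_intros)
  hence poly_bounded: "(\<lambda>j. poly Q (r j)) \<in> O[at_top](\<lambda>_. 1)"
    by (intro bigoI_tendsto[where c = "poly Q 0"]) auto
  have "(\<lambda>j. r j ^ (n + 2) * poly Q (r j)) \<in> O[at_top](\<lambda>j. (1 / of_int j) ^ (n + 2) * 1)"
    by (intro landau_o.big.mult landau_o.big_power r1 poly_bounded)
  hence "(\<lambda>j. r j ^ (n + 2) * poly Q (r j)) \<in> O[at_top](\<lambda>j. 1 / of_int j ^ (n + 2))"
    by (simp add: power_one_over)
  hence tail: "(\<lambda>j. r j ^ (n + 2) * poly Q (r j)) \<in> O[at_top](\<lambda>j. ln (of_int j) / of_int j ^ (n + 2))"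
    using inv_le by (rule landau_o.big.trans)
  have "(\<lambda>j. r j ^ (n + 1) - q j ^ (n + 1)) \<in>
      O[at_top](\<lambda>j. (1 / of_int j) ^ n * (ln (of_int j) / of_int j ^ 2))"
    by (rule bigo_power_diff[OF r1 q r2])
  also have "(\<lambda>j. (1 / of_int j) ^ n * (ln (of_int j) / of_int j ^ 2)) =
      (\<lambda>j::int. ln (of_int j) / real_of_int j ^ (n + 2))"
    by (simp add: power_one_over power2_eq_square mult_ac)
  finally have head: "(\<lambda>j. r j ^ (n + 1) - q j ^ (n + 1)) \<in>
      O[at_top](\<lambda>j. ln (of_int j) / of_int j ^ (n + 2))" .
  have "(\<lambda>j. B ^ n * (fact n * (r j ^ (n + 1) - q j ^ (n + 1)) + r j ^ (n + 2) * poly Q (r j)))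
      \<in> O[at_top](\<lambda>j. ln (of_int j) / of_int j ^ (n + 2))"
  proof -
    have "(\<lambda>j. fact n * (r j ^ (n + 1) - q j ^ (n + 1))) \<in> O[at_top](\<lambda>j. ln (of_int j) / of_int j ^ (n + 2))"
      using head by (subst landau_o.big.cmult_in_iff) simp_all
    from sum_in_bigo(1)[OF this tail] B show ?thesis
      by (subst landau_o.big.cmult_in_iff) simp_all
  qed
  moreover have "\<forall>\<^sub>F j in at_top. (- 1) ^ n * g j - fact n / (B * of_int j ^ (n + 1)) =
      B ^ n * (fact n * (r j ^ (n + 1) - q j ^ (n + 1)) + r j ^ (n + 2) * poly Q (r j))"
    using large
  proof eventually_elim
    case (elim j)
    have "(- 1) ^ n * g j = B ^ n * ((- 1) ^ n * rate_deriv L n (\<eta> j))"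
      using \<eta> elim by simp
    also have "\<dots> = B ^ n * (fact n * r j ^ (n + 1) + r j ^ (n + 2) * poly Q (r j))"
      unfolding Q r_def ..
    finally have 1: "(- 1) ^ n * g j = B ^ n * (fact n * r j ^ (n + 1) + r j ^ (n + 2) * poly Q (r j))" .
    have 2: "fact n / (B * of_int j ^ (n + 1)) = B ^ n * (fact n * q j ^ (n + 1))"
      using B elim by (simp add: q_def field_simps)
    show ?case unfolding 1 2 by (simp add: algebra_simps)
  qed
  ultimately show ?thesis
    unfolding g_def[symmetric] by (subst landau_o.big.in_cong)
qed


theorem proposition3p3:
  fixes b :: int and c \<rho> C L B :: real
    and G R W :: "real \<Rightarrow> real"
    and x z w :: "int \<Rightarrow> real"
    and layers :: "int set"
  assumes b: "b \<ge> 2" and c: "c \<ge> 2"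
    and \<rho>: "\<rho> = frac (log (of_int b) c)" "0 < \<rho>" "\<rho> < 1"
    and C: "C = of_int b powr \<rho>"
    and L: "L = ln C"
    and B: "B = ln (of_int b)"
    and G: "G = large_branch_inv L"
    and R: "R = (\<lambda>J. 1 / (L * G J - 1))"
    and W: "W = (\<lambda>J. G (J + L) - G J - 1)"
    and layers: "layers = {j. of_int j * B > 1 + ln L}"
    and x: "x = (\<lambda>j. G (of_int j * B))"
    and z: "z = (\<lambda>j. G (of_int j * B + L) - 1)"
    and w: "w = (\<lambda>j. z j - x j)"
  shows
    "(\<forall>J > 1 + ln L.
        R integrable_on {J..J + L} \<and>
        W J = 1 / L * integral {J..J + L} R \<and>
        (R has_real_derivative - (R J)\<^sup>2 * (1 + R J)) (at J)) \<and>
     (\<forall>n. \<forall>J > 1 + ln L.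
        (deriv ^^ n) W field_differentiable at J \<and>
        (-1) ^ n * (deriv ^^ n) W J > 0) \<and>
     (\<forall>j \<in> layers.
        w j = W (of_int j * B) \<and>
        1 / (L * (z j + 1) - 1) < w j \<and> w j < 1 / (L * x j - 1) \<and>
        (w j < 1 \<longleftrightarrow> x j > 2 / (exp L - 1))) \<and>
     2 / (exp L - 1) = 2 / (C - 1) \<and>
     (\<forall>n. \<forall>j \<in> layers. (-1) ^ n * (fwd_diff ^^ n) w j > 0) \<and>
     (\<forall>n. (\<lambda>j. (-1) ^ n * (fwd_diff ^^ n) w j - fact n / (B * of_int j ^ (n + 1)))
            \<in> O[at_top](\<lambda>j. ln (of_int j) / of_int j ^ (n + 2))) \<and>
     strict_antimono_on layers w \<and>
     strictly_convex_seq_on layers w"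
proof -
  have B0: "B > 0" and b1: "real_of_int b > 1" using b B by auto
  \<comment> \<open>The large branch makes sense only for \<open>L > 0\<close>, which \<open>0 < \<rho>\<close> provides.\<close>
  have L_eq: "L = \<rho> * B" using C L B b1 by (simp add: ln_powr)
  have L0: "L > 0" using L_eq \<rho>(2) B0 by simp
  have expL: "exp L = C" using C L b1 by (simp add: powr_def)
  have R_eq: "R = rate L" unfolding R G rate_def ..
  have W_eq: "W = width_deriv L 0" unfolding W G using L0 by (auto simp: width_deriv_0)
  have w_eq: "w = (\<lambda>j. width_deriv L 0 (of_int j * B))"
    unfolding w z x G using L0 by (auto simp: width_deriv_0)
  have wW: "w j = W (of_int j * B)" for j by (simp add: w_eq W_eq)
  have diffs: "(- 1) ^ n * (fwd_diff ^^ n) w j > 0" if j: "j \<in> layers" for n j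
  proof -
    obtain \<eta> where \<eta>: "of_int j * B < \<eta>" "(fwd_diff ^^ n) w j = B ^ n * rate_deriv L n \<eta>"
      unfolding w_eq using fwd_diff_width_mean_value[OF L0 B0] j layers by blast
    have "(- 1) ^ n * rate_deriv L n \<eta> > 0"
      using j layers \<eta>(1) by (intro rate_deriv_alternates L0) auto
    hence "B ^ n * ((- 1) ^ n * rate_deriv L n \<eta>) > 0" using B0 by simp
    thus ?thesis unfolding \<eta>(2) by (simp only: mult_ac)
  qed
  have 1: "\<forall>J > 1 + ln L.
        R integrable_on {J..J + L} \<and>
        W J = 1 / L * integral {J..J + L} R \<and>
        (R has_real_derivative - (R J)\<^sup>2 * (1 + R J)) (at J)"
    unfolding R_eq W_eq
  proof (intro allI impI conjI)
    fix J assume J: "1 + ln L < J"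
    note int = rate_has_integral_width[OF L0 J]
    show "rate L integrable_on {J..J + L}" using int by (rule has_integral_integrable)
    show "width_deriv L 0 J = 1 / L * integral {J..J + L} (rate L)"
      using integral_unique[OF int] L0 by simp
  qed (rule DERIV_rate[OF L0])
  have 2: "\<forall>n. \<forall>J > 1 + ln L.
        (deriv ^^ n) W field_differentiable at J \<and> (-1) ^ n * (deriv ^^ n) W J > 0"
    unfolding W_eq
    using deriv_funpow_eq_on_ray[of "1 + ln L" "width_deriv L", OF DERIV_width_deriv[OF L0]]
      width_deriv_alternates[OF L0]
    by (auto simp: field_differentiable_def)
  have 3: "\<forall>j \<in> layers.
        w j = W (of_int j * B) \<and>
        1 / (L * (z j + 1) - 1) < w j \<and> w j < 1 / (L * x j - 1) \<and>
        (w j < 1 \<longleftrightarrow> x j > 2 / (exp L - 1))"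
  proof
    fix j assume "j \<in> layers"
    hence j: "of_int j * B > 1 + ln L" by (simp add: layers)
    have "1 / (L * (z j + 1) - 1) = rate L (of_int j * B + L)"
      by (simp add: z G rate_def)
    moreover have "1 / (L * x j - 1) = rate L (of_int j * B)"
      by (simp add: x G rate_def)
    moreover have "x j = large_branch_inv L (of_int j * B)" by (simp add: x G)
    ultimately show "w j = W (of_int j * B) \<and>
        1 / (L * (z j + 1) - 1) < w j \<and> w j < 1 / (L * x j - 1) \<and>
        (w j < 1 \<longleftrightarrow> x j > 2 / (exp L - 1))"
      using width_between_rates[OF L0 j] width_less_one_iff[OF L0 j] by (simp add: wW W_eq)
  qed
  have 4: "\<forall>n. (\<lambda>j. (-1) ^ n * (fwd_diff ^^ n) w j - fact n / (B * of_int j ^ (n + 1)))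
            \<in> O[at_top](\<lambda>j. ln (of_int j) / of_int j ^ (n + 2))"
    unfolding w_eq using fwd_diff_width_asymptotics[OF L0 B0] by blast
  have 5: "strict_antimono_on layers w"
  proof (rule monotone_onI)
    fix i j assume ij: "i \<in> layers" "j \<in> layers" "i < j"
    have "width_deriv L 0 (of_int j * B) < width_deriv L 0 (of_int i * B)"
    proof (rule DERIV_neg_imp_decreasing[where f = "width_deriv L 0"])
      show "real_of_int i * B < real_of_int j * B" using ij B0 by simp
      fix t assume "of_int i * B \<le> t" "t \<le> of_int j * B"
      hence t: "t > 1 + ln L" using ij layers by auto
      show "\<exists>y. (width_deriv L 0 has_real_derivative y) (at t) \<and> y < 0"
        using DERIV_width_deriv[OF L0 t, of 0] width_deriv_alternates[OF L0 t, of 1] by auto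
    qed
    thus "w i > w j" by (simp add: w_eq)
  qed
  have 6: "strictly_convex_seq_on layers w"
    unfolding strictly_convex_seq_on_def
  proof safe
    fix j assume "j \<in> layers"
    from diffs[OF this, of 2] show "2 * w (j + 1) < w j + w (j + 2)"
      by (simp add: numeral_2_eq_2 fwd_diff_def add.commute)
  qed
  show ?thesis using 1 2 3 4 5 6 diffs expL by blast
qed

end
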